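(* Let $\rho_1^{X_1B_1}$ and $\rho_2^{X_2B_2}$ be classical-quantum states $\rho_i^{X_iB_i}=\frac12|0\rangle\langle0|\otimes\sigma_0^{B_i}+\frac12|1\rangle\langle1|\otimes\sigma_1^{B_i}$, with $\sigma_0^{B_i},\sigma_1^{B_i}$ quantum states on a finite-dimensional system $B_i$ ($i=1,2$), and let $$\tau^{(X_1+X_2)X_2B_1B_2}=\sum_{x_1,x_2\in\{0,1\}}\tfrac14\,|x_1\oplus x_2\rangle\langle x_1\oplus x_2|\otimes|x_2\rangle\langle x_2|\otimes\sigma_{x_1}^{B_1}\otimes\sigma_{x_2}^{B_2}.$$ Then $$\widetilde H_2^\downarrow(X_1+X_2|B_1B_2)_\tau=-\log\left[2\Big(\tfrac12-e^{-\widetilde H_2^\downarrow(X_1|B_1)_{\rho_1}}\Big)\Big(\tfrac12-e^{-\widetilde H_2^\downarrow(X_2|B_2)_{\rho_2}}\Big)+\tfrac12\right].$$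
   Context: For a finite-dimensional quantum state $\rho_{AB}$ with reduced state $\rho_B=\operatorname{Tr}_A\rho_{AB}$, $$\widetilde H^\downarrow_\alpha(A|B)_\rho=\frac{1}{1-\alpha}\log\operatorname{Tr}\Big[\Big(\rho_B^{\frac{1-\alpha}{2\alpha}}\rho_{AB}\,\rho_B^{\frac{1-\alpha}{2\alpha}}\Big)^\alpha\Big],$$ so that $\widetilde H_2^\downarrow(A|B)_\rho=-\log\operatorname{Tr}\big[(\rho_B^{-1/4}\rho_{AB}\,\rho_B^{-1/4})^2\big]$. Here $\rho_B^{s}$ means $I_A\otimes\rho_B^s$, negative powers are taken on the support, and $\log$ is the natural logarithm. $\widetilde H_2^\downarrow(X_1+X_2|B_1B_2)_\tau$ is evaluated on the reduced state of $\tau$ on the first register $X_1+X_2$ and $B_1B_2$. *)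

theory Defs
  imports "HOL-Analysis.Analysis"
begin

text \<open>
  A finite-dimensional quantum system is modelled by \<open>complex ^ 'n\<close> with a finite index type \<open>'n\<close>,
  its operators by \<open>complex ^ 'n ^ 'n\<close>, and a composite system by the product of the index types,
  associated to the right. A bit register has index type \<open>2\<close>, the integers modulo two, so that
  addition on this type is the exclusive or.
\<close>

definition dagger :: "complex ^ 'n ^ 'm \<Rightarrow> complex ^ 'm ^ 'n" where
  "dagger A = (\<chi> i j. cnj (A $ j $ i))"

definition hermitian :: "complex ^ 'n ^ 'n \<Rightarrow> bool" where
  "hermitian A \<longleftrightarrow> dagger A = A"

definition unitary :: "complex ^ 'n ^ 'n \<Rightarrow> bool" where
  "unitary U \<longleftrightarrow> dagger U ** U = mat 1 \<and> U ** dagger U = mat 1"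

definition positive_semidefinite :: "complex ^ 'n ^ 'n \<Rightarrow> bool" where
  "positive_semidefinite A \<longleftrightarrow>
     hermitian A \<and> (\<forall>v. 0 \<le> Re (\<Sum>i\<in>UNIV. cnj (v $ i) * (A *v v) $ i))"

definition quantum_state :: "complex ^ 'n ^ 'n \<Rightarrow> bool" where
  "quantum_state \<rho> \<longleftrightarrow> positive_semidefinite \<rho> \<and> trace \<rho> = 1"

definition real_diag :: "('n \<Rightarrow> real) \<Rightarrow> complex ^ 'n ^ 'n" where
  "real_diag d = (\<chi> i j. if i = j then complex_of_real (d i) else 0)"

text \<open>
  Functional calculus of a Hermitian matrix. The value does not depend on the chosen
  diagonalisation: see \<open>hermitian_fun_eqI\<close> below.
\<close>

definition hermitian_fun :: "(real \<Rightarrow> real) \<Rightarrow> complex ^ 'n ^ 'n \<Rightarrow> complex ^ 'n ^ 'n" where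
  "hermitian_fun f A = (THE B. \<exists>U d. unitary U \<and> A = U ** real_diag d ** dagger U \<and>
                                     B = U ** real_diag (f \<circ> d) ** dagger U)"

lemma real_diag_mult_left: "(real_diag d ** A) $ i $ j = complex_of_real (d i) * A $ i $ j"
proof -
  have "(real_diag d ** A) $ i $ j =
      (\<Sum>k\<in>UNIV. if k = i then complex_of_real (d i) * A $ k $ j else 0)"
    unfolding matrix_matrix_mult_def real_diag_def vec_lambda_beta
    by (rule sum.cong) auto
  then show ?thesis by simp
qed

lemma real_diag_mult_right: "(A ** real_diag d) $ i $ j = A $ i $ j * complex_of_real (d j)"
proof -
  have "(A ** real_diag d) $ i $ j =
      (\<Sum>k\<in>UNIV. if k = j then A $ i $ k * complex_of_real (d j) else 0)"
    unfolding matrix_matrix_mult_def real_diag_def vec_lambda_beta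
    by (rule sum.cong) auto
  then show ?thesis by simp
qed

lemma diagonalisation_unique:
  assumes U: "unitary U" and V: "unitary V"
    and eq: "U ** real_diag d ** dagger U = V ** real_diag e ** dagger V"
  shows "U ** real_diag (f \<circ> d) ** dagger U = V ** real_diag (f \<circ> e) ** dagger V"
proof -
  define W where "W = dagger V ** U"
  have "W ** real_diag d = dagger V ** U ** real_diag d ** (dagger U ** U)"
    using U by (simp add: W_def unitary_def)
  also have "\<dots> = dagger V ** (U ** real_diag d ** dagger U) ** U"
    by (simp add: matrix_mul_assoc)
  also have "\<dots> = (dagger V ** V) ** real_diag e ** (dagger V ** U)"
    by (simp add: eq matrix_mul_assoc)
  also have "\<dots> = real_diag e ** W"
    using V by (simp add: W_def unitary_def)
  finally have W: "W ** real_diag d = real_diag e ** W" .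
  have "W $ i $ j * complex_of_real (f (d j)) = complex_of_real (f (e i)) * W $ i $ j" for i j
  proof -
    have "W $ i $ j * complex_of_real (d j) = complex_of_real (e i) * W $ i $ j"
      using W by (metis real_diag_mult_left real_diag_mult_right)
    then have "W $ i $ j = 0 \<or> d j = e i"
      by (metis mult.commute mult_cancel_left of_real_eq_iff)
    then show ?thesis
      by auto
  qed
  then have "W ** real_diag (f \<circ> d) = real_diag (f \<circ> e) ** W"
    unfolding vec_eq_iff real_diag_mult_left real_diag_mult_right by simp
  then have "V ** (W ** real_diag (f \<circ> d)) ** dagger U = V ** (real_diag (f \<circ> e) ** W) ** dagger U"
    by simp
  then have "(V ** dagger V) ** U ** real_diag (f \<circ> d) ** dagger U =
      V ** real_diag (f \<circ> e) ** dagger V ** (U ** dagger U)"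
    by (simp add: W_def matrix_mul_assoc)
  then show ?thesis
    using U V by (simp add: unitary_def)
qed

lemma hermitian_fun_eqI:
  assumes "unitary U" "A = U ** real_diag d ** dagger U"
  shows "hermitian_fun f A = U ** real_diag (f \<circ> d) ** dagger U"
  unfolding hermitian_fun_def
proof (rule the_equality)
  show "\<exists>V e. unitary V \<and> A = V ** real_diag e ** dagger V \<and>
      U ** real_diag (f \<circ> d) ** dagger U = V ** real_diag (f \<circ> e) ** dagger V"
    using assms by blast
next
  fix B
  assume "\<exists>V e. unitary V \<and> A = V ** real_diag e ** dagger V \<and>
      B = V ** real_diag (f \<circ> e) ** dagger V"
  then show "B = U ** real_diag (f \<circ> d) ** dagger U"
    using assms diagonalisation_unique by metis
qed

text \<open>
  Since \<open>0 powr s = 0\<close> for every \<open>s\<close>, the eigenvalue zero is always mapped to zero. Negative powers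
  of a positive semidefinite matrix are thus taken on its support.
\<close>

definition matrix_powr :: "complex ^ 'n ^ 'n \<Rightarrow> real \<Rightarrow> complex ^ 'n ^ 'n" where
  "matrix_powr A s = hermitian_fun (\<lambda>x. x powr s) A"

definition tensor ::
    "complex ^ 'a ^ 'a \<Rightarrow> complex ^ 'b ^ 'b \<Rightarrow>
     complex ^ ('a::finite \<times> 'b::finite) ^ ('a \<times> 'b)"
    (infixr \<open>\<otimes>\<close> 70) where
  "A \<otimes> B = (\<chi> p q. A $ fst p $ fst q * B $ snd p $ snd q)"

definition basis_projector :: "'n \<Rightarrow> complex ^ 'n ^ 'n" where
  "basis_projector x = (\<chi> i j. if i = x \<and> j = x then 1 else 0)"

definition trace_out_first ::
    "complex ^ ('a::finite \<times> 'b::finite) ^ ('a \<times> 'b) \<Rightarrow> complex ^ 'b ^ 'b" where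
  "trace_out_first \<rho> = (\<chi> i j. \<Sum>a\<in>UNIV. \<rho> $ (a, i) $ (a, j))"

definition trace_out_second ::
    "complex ^ ('a::finite \<times> 'c::finite \<times> 'b::finite) ^ ('a \<times> 'c \<times> 'b) \<Rightarrow>
     complex ^ ('a::finite \<times> 'b::finite) ^ ('a \<times> 'b)" where
  "trace_out_second \<rho> = (\<chi> p q. \<Sum>c\<in>UNIV. \<rho> $ (fst p, c, snd p) $ (fst q, c, snd q))"

text \<open>
  The sandwiched conditional Renyi entropy of the first factor given the second one, relative to
  the marginal. The trace of a power of a Hermitian matrix is real, so \<open>Re\<close> is only a coercion.
\<close>

definition sandwiched_entropy_down ::
    "real \<Rightarrow> complex ^ ('a::finite \<times> 'b::finite) ^ ('a \<times> 'b) \<Rightarrow> real" where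
  "sandwiched_entropy_down \<alpha> \<rho> =
     (let \<rho>\<^sub>B = trace_out_first \<rho>;
          S = mat 1 \<otimes> matrix_powr \<rho>\<^sub>B ((1 - \<alpha>) / (2 * \<alpha>))
      in 1 / (1 - \<alpha>) * ln (Re (trace (matrix_powr (S ** \<rho> ** S) \<alpha>))))"

end

theory Submission
  imports Defs
begin

text \<open>
  For a classical-quantum state with a uniform bit, put \<open>T = \<rho>\<^sub>B powr (-1/4)\<close> and
  \<open>D = T (\<sigma>\<^sub>0 - \<sigma>\<^sub>1) T / 2\<close>. The mean of \<open>T \<sigma>\<^sub>0 T\<close> and \<open>T \<sigma>\<^sub>1 T\<close> is the square root of \<open>\<rho>\<^sub>B\<close>, whose
  square has trace one, so by the parallelogram identity the exponential of the negated entropy is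
  \<open>(1 + Tr D\<^sup>2) / 2\<close>. Taking the sum of the two bits turns \<open>D\<close> into \<open>D\<^sub>1 \<otimes> D\<^sub>2\<close>, and the trace of the
  square of a tensor product is multiplicative.
\<close>

section \<open>The complex inner product and the spectral theorem for Hermitian matrices\<close>

definition cinner :: "complex ^ 'n \<Rightarrow> complex ^ 'n \<Rightarrow> complex" where
  "cinner u v = (\<Sum>i\<in>UNIV. cnj (u $ i) * v $ i)"

lemma cinner_add_right: "cinner u (v + w) = cinner u v + cinner u w"
  by (simp add: cinner_def algebra_simps sum.distrib)

lemma cinner_scaleR_right: "cinner u (r *\<^sub>R v) = r *\<^sub>R cinner u v"
  by (simp add: cinner_def scaleR_sum_right)

lemma cinner_scaleR_left: "cinner (r *\<^sub>R u) v = r *\<^sub>R cinner u v"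
  by (simp add: cinner_def scaleR_sum_right)

lemma cinner_commute: "cinner v u = cnj (cinner u v)"
  by (simp add: cinner_def mult.commute)

text \<open>This is the bridge to real analysis: the library's inner product, norm and compact
  spheres on \<open>complex ^ 'n\<close> are those of the underlying real space.\<close>

lemma Re_cinner: "Re (cinner u v) = u \<bullet> v"
  by (simp add: cinner_def inner_vec_def inner_complex_def)

lemma cinner_self: "cinner u u = complex_of_real ((norm u)\<^sup>2)"
  using Re_cinner[of u u] cinner_commute[of u u]
  by (simp add: complex_eq_iff power2_norm_eq_inner)

lemma hermitian_nth: "hermitian A \<Longrightarrow> A $ i $ j = cnj (A $ j $ i)"
  unfolding hermitian_def dagger_def vec_eq_iff by simp

lemma cinner_hermitian:
  assumes "hermitian A"
  shows "cinner u (A *v v) = cinner (A *v u) v"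
proof -
  have "cinner u (A *v v) = (\<Sum>i\<in>UNIV. \<Sum>j\<in>UNIV. cnj (u $ i) * A $ i $ j * v $ j)"
    by (simp add: cinner_def matrix_vector_mult_def sum_distrib_left mult.assoc)
  also have "\<dots> = (\<Sum>j\<in>UNIV. \<Sum>i\<in>UNIV. cnj (A $ j $ i * u $ i) * v $ j)"
    by (subst sum.swap, intro sum.cong refl, subst hermitian_nth[OF assms]) (simp add: mult_ac)
  also have "\<dots> = cinner (A *v u) v"
    by (simp add: cinner_def matrix_vector_mult_def sum_distrib_right)
  finally show ?thesis .
qed

text \<open>The maximiser of the Rayleigh quotient over the unit sphere of the invariant subspace is an
  eigenvector, because \<open>\<lambda> - A\<close> is positive there and its form vanishes at the maximiser.\<close>

lemma hermitian_eigenvector_in_invariant_subspace: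
  fixes A :: "complex ^ 'n ^ 'n"
  assumes A: "hermitian A" and W: "subspace W" and inv: "\<And>v. v \<in> W \<Longrightarrow> A *v v \<in> W"
    and "x \<in> W" and "x \<noteq> 0"
  obtains v r where "v \<in> W" and "norm v = 1" and "A *v v = r *\<^sub>R v"
proof -
  \<comment> \<open>Linearity and subspaces are meant over the reals. This suffices, because the
    eigenvalue to be found is real.\<close>
  have lin: "linear ((*v) A)"
    by (rule linearI) (simp_all add: matrix_vector_mult_def vec_eq_iff scaleR_sum_right
        sum.distrib algebra_simps)
  have sym: "u \<bullet> (A *v v) = (A *v u) \<bullet> v" for u v
    using cinner_hermitian[OF A, of u v] by (metis Re_cinner)
  have "compact (sphere 0 1 \<inter> W)"
    by (intro compact_Int_closed compact_sphere closed_subspace W)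
  moreover have "x /\<^sub>R norm x \<in> sphere 0 1 \<inter> W"
    using assms(4,5) W by (simp add: subspace_scale)
  moreover have "continuous_on (sphere 0 1 \<inter> W) (\<lambda>v. v \<bullet> (A *v v))"
    by (intro continuous_intros linear_continuous_on linear_conv_bounded_linear[THEN iffD1] lin)
  ultimately obtain v where v: "v \<in> sphere 0 1 \<inter> W"
    and max: "\<And>y. y \<in> sphere 0 1 \<inter> W \<Longrightarrow> y \<bullet> (A *v y) \<le> v \<bullet> (A *v v)"
    using continuous_attains_sup[of "sphere 0 1 \<inter> W" "\<lambda>v. v \<bullet> (A *v v)"] by blast
  define r where "r = v \<bullet> (A *v v)"
  define B where "B = (\<lambda>y. r *\<^sub>R y - A *v y)"
  have nv: "norm v = 1" "v \<in> W" using v by auto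
  have linB: "B (y + t *\<^sub>R z) = B y + t *\<^sub>R B z" for y z t
    by (simp add: B_def linear_add[OF lin] linear_scale[OF lin] algebra_simps)
  have symB: "u \<bullet> B y = B u \<bullet> y" for u y
    by (simp add: B_def algebra_simps sym)
  \<comment> \<open>The form of \<open>B\<close> is homogeneous of degree two, so its sign is
    decided on unit vectors, where the maximality of \<open>r\<close> applies.\<close>
  have pos: "0 \<le> y \<bullet> B y" if "y \<in> W" for y
  proof (cases "y = 0")
    case False
    define z where "z = y /\<^sub>R norm y"
    have y: "y = norm y *\<^sub>R z" using False by (simp add: z_def)
    have z: "z \<in> sphere 0 1 \<inter> W"
      using False that W by (simp add: z_def subspace_scale)
    have "z \<bullet> B z = r - z \<bullet> (A *v z)"
      using z by (simp add: B_def algebra_simps dot_square_norm)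
    then have "0 \<le> z \<bullet> B z" using max[OF z] by (simp add: r_def)
    moreover have "B y = norm y *\<^sub>R B z"
      using linB[of 0 "norm y" z] y by (simp add: B_def)
    then have "y \<bullet> B y = (norm y)\<^sup>2 * (z \<bullet> B z)"
      by (subst y) (simp add: power2_eq_square)
    ultimately show ?thesis by simp
  qed simp
  define w where "w = B v"
  have w: "w \<in> W"
    using nv W inv by (simp add: w_def B_def subspace_diff subspace_scale)
  have vBv: "v \<bullet> B v = 0"
    using nv by (simp add: B_def algebra_simps dot_square_norm r_def)
  \<comment> \<open>The nonnegative form is evaluated along the line from \<open>v\<close> in
    direction \<open>w = B v\<close>. Its constant term is \<open>v \<bullet> B v = 0\<close> and
    its linear coefficient is \<open>2 * (w \<bullet> w)\<close>, so it would become negative for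
    small negative \<open>t\<close> unless \<open>w = 0\<close>.\<close>
  have q: "0 \<le> 2 * t * (w \<bullet> w) + t\<^sup>2 * (w \<bullet> B w)" for t
  proof -
    have "0 \<le> (v + t *\<^sub>R w) \<bullet> B (v + t *\<^sub>R w)"
      using nv w W by (intro pos) (simp add: subspace_add subspace_scale)
    also have "\<dots> = 2 * t * (w \<bullet> w) + t\<^sup>2 * (w \<bullet> B w)"
      using vBv symB[of v w]
      by (simp add: linB inner_add_left inner_add_right w_def[symmetric] power2_eq_square algebra_simps)
    finally show ?thesis .
  qed
  have "w \<bullet> w \<le> 0"
  proof (rule ccontr)
    assume "\<not> w \<bullet> w \<le> 0"
    then have a: "w \<bullet> w > 0" by linarith
    have b: "w \<bullet> B w \<ge> 0" by (rule pos[OF w])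
    \<comment> \<open>The added 1 keeps the denominator positive when \<open>w \<bullet> B w\<close>
      vanishes. With this choice the form equals \<open>t * (w \<bullet> w) - t\<^sup>2\<close>,
      which is negative.\<close>
    define t where "t = - (w \<bullet> w) / (w \<bullet> B w + 1)"
    have t: "t < 0" using a b by (simp add: t_def field_simps)
    have "t * (w \<bullet> B w + 1) = - (w \<bullet> w)" using b by (simp add: t_def)
    then have "t * (w \<bullet> B w) = - (w \<bullet> w) - t" by (simp add: algebra_simps)
    then have "2 * t * (w \<bullet> w) + t\<^sup>2 * (w \<bullet> B w) = t * (w \<bullet> w) - t\<^sup>2"
      by (simp add: power2_eq_square mult.assoc) (simp add: algebra_simps)
    moreover have "t * (w \<bullet> w) < 0" using t a by (simp add: mult_neg_pos)
    ultimately show False using q[of t] zero_le_power2[of t] by linarith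
  qed
  then have "w = 0" by (metis inner_gt_zero_iff not_le)
  then have "A *v v = r *\<^sub>R v" by (simp add: w_def B_def)
  with nv show thesis by (intro that)
qed

lemma exists_nonzero_orthogonal_vector:
  fixes u :: "'n \<Rightarrow> complex ^ 'n"
  assumes "j \<notin> J"
  obtains x where "x \<noteq> 0" and "\<And>k. k \<in> J \<Longrightarrow> cinner (u k) x = 0"
proof -
  \<comment> \<open>The zero row \<open>j\<close> makes \<open>M\<close> singular.\<close>
  define M :: "complex ^ 'n ^ 'n" where
    "M = (\<chi> k i. if k \<in> J then cnj (u k $ i) else 0)"
  have "det M = 0"
    by (rule det_zero_row[of j]) (use assms in \<open>simp add: M_def row_def vec_eq_iff\<close>)
  then have "\<not> (\<exists>B. B ** M = mat 1)"
    by (metis invertible_det_nz invertible_left_inverse)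
  then obtain x where x: "x \<noteq> 0" "M *v x = 0"
    unfolding matrix_left_invertible_ker by blast
  have "cinner (u k) x = 0" if "k \<in> J" for k
  proof -
    have "(M *v x) $ k = 0" using x by simp
    then show ?thesis using that by (simp add: M_def matrix_vector_mult_def cinner_def)
  qed
  with x show thesis by (intro that)
qed

text \<open>Induction on the index set. The orthogonal complement of the eigenvectors found so far
  is invariant, since \<open>A\<close> can be moved onto \<open>u k\<close>, where it acts as the
  real factor \<open>d k\<close>. It is also nonzero, so it contains a further unit eigenvector. The
  case of all indices is an orthonormal eigenbasis.\<close>

lemma hermitian_orthonormal_eigenvectors:
  fixes A :: "complex ^ 'n ^ 'n"
  assumes A: "hermitian A" and "finite J"
  shows "\<exists>u d. (\<forall>j\<in>J. \<forall>k\<in>J. cinner (u j) (u k) = (if j = k then 1 else 0)) \<and>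
    (\<forall>j\<in>J. A *v u j = d j *\<^sub>R u (j :: 'n))"
  using \<open>finite J\<close>
proof (induction J)
  case empty
  then show ?case by simp
next
  case (insert a J)
  from insert.IH obtain u d where
      u: "\<forall>j\<in>J. \<forall>k\<in>J. cinner (u j) (u k) = (if j = k then 1 else 0)"
    and d: "\<forall>j\<in>J. A *v u j = d j *\<^sub>R u j"
    by (elim exE conjE)
  define W where "W = {x. \<forall>k\<in>J. cinner (u k) x = 0}"
  have subW: "subspace W"
    by (auto simp: subspace_def W_def cinner_add_right cinner_scaleR_right) (simp add: cinner_def)
  have invW: "A *v x \<in> W" if "x \<in> W" for x
  proof -
    have "cinner (d k *\<^sub>R u k) x = 0" if "k \<in> J" for k
      using \<open>x \<in> W\<close> that by (simp add: W_def cinner_scaleR_left)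
    then show ?thesis
      using d by (simp add: W_def cinner_hermitian[OF A])
  qed
  obtain x where x: "x \<noteq> 0" and "\<And>k. k \<in> J \<Longrightarrow> cinner (u k) x = 0"
    using exists_nonzero_orthogonal_vector[OF \<open>a \<notin> J\<close>, of u] by metis
  then have "x \<in> W" by (simp add: W_def)
  obtain v r where v: "v \<in> W" "norm v = 1" "A *v v = r *\<^sub>R v"
    using hermitian_eigenvector_in_invariant_subspace[OF A subW invW \<open>x \<in> W\<close> x] .
  have vv: "cinner v v = 1" using v by (simp add: cinner_self)
  have uv: "cinner (u k) v = 0" "cinner v (u k) = 0" if "k \<in> J" for k
    using v that by (simp_all add: W_def cinner_commute[of v "u k"])
  have ortho: "cinner ((u(a := v)) j) ((u(a := v)) k) = (if j = k then 1 else 0)"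
    if "j \<in> insert a J" "k \<in> insert a J" for j k
    using that u vv uv by (cases "j = a"; cases "k = a") simp_all
  have eigen: "A *v (u(a := v)) j = (d(a := r)) j *\<^sub>R (u(a := v)) j" if "j \<in> insert a J" for j
    using that d v by (cases "j = a") simp_all
  show ?case
    by (intro exI[of _ "u(a := v)"] exI[of _ "d(a := r)"] conjI ballI ortho eigen)
qed

text \<open>The columns of \<open>U\<close> are an orthonormal eigenbasis. Together with
  \<open>hermitian_fun_eqI\<close> this makes the definite description behind every power of a
  Hermitian matrix computable.\<close>

theorem hermitian_diagonalisable:
  fixes A :: "complex ^ 'n ^ 'n"
  assumes "hermitian A"
  obtains U d where "unitary U" and "A = U ** real_diag d ** dagger U"
proof -
  obtain u d where u: "\<And>j k. cinner (u j) (u k) = (if j = k then 1 else 0)"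
    and d: "\<And>j. A *v u j = d j *\<^sub>R u (j :: 'n)"
    using hermitian_orthonormal_eigenvectors[OF assms, of UNIV] by auto
  define U :: "complex ^ 'n ^ 'n" where "U = (\<chi> i j. u j $ i)"
  have "dagger U ** U = mat 1"
    using u by (simp add: vec_eq_iff dagger_def U_def matrix_matrix_mult_def mat_def cinner_def)
  then have U: "unitary U"
    by (simp add: unitary_def matrix_left_right_inverse)
  have "(A ** U) $ i $ j = (U ** real_diag d) $ i $ j" for i j
  proof -
    have "(A ** U) $ i $ j = (A *v u j) $ i"
      by (simp add: U_def matrix_matrix_mult_def matrix_vector_mult_def)
    also have "\<dots> = (U ** real_diag d) $ i $ j"
      unfolding real_diag_mult_right by (simp add: d U_def) (simp add: scaleR_conv_of_real)
    finally show ?thesis .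
  qed
  then have AU: "A ** U = U ** real_diag d" by (simp add: vec_eq_iff)
  have "A = A ** (U ** dagger U)" using U by (simp add: unitary_def)
  also have "\<dots> = U ** real_diag d ** dagger U" by (simp add: matrix_mul_assoc AU)
  finally show thesis using U that by blast
qed

section \<open>Algebra of matrices, adjoints and traces\<close>

lemma matrix_add_rdistrib: "(A + B) ** C = A ** C + B ** C"
  by (simp add: matrix_matrix_mult_def vec_eq_iff distrib_right sum.distrib)

lemma matrix_diff_ldistrib: "A ** (B - C) = A ** B - A ** C" for A :: "'a::ring_1 ^ 'n ^ 'm"
  by (simp add: matrix_matrix_mult_def vec_eq_iff right_diff_distrib sum_subtractf)

lemma matrix_diff_rdistrib: "(A - B) ** C = A ** C - B ** C" for A :: "'a::ring_1 ^ 'n ^ 'm"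
  by (simp add: matrix_matrix_mult_def vec_eq_iff left_diff_distrib sum_subtractf)

lemma dagger_dagger: "dagger (dagger A) = A"
  by (simp add: dagger_def vec_eq_iff)

lemma dagger_mult: "dagger (A ** B) = dagger B ** dagger A"
  by (simp add: dagger_def matrix_matrix_mult_def vec_eq_iff mult.commute)

lemma hermitian_add: "hermitian A \<Longrightarrow> hermitian B \<Longrightarrow> hermitian (A + B)"
  by (simp add: hermitian_def dagger_def vec_eq_iff)

lemma hermitian_diff: "hermitian A \<Longrightarrow> hermitian B \<Longrightarrow> hermitian (A - B)"
  by (simp add: hermitian_def dagger_def vec_eq_iff)

lemma hermitian_scaleR: "hermitian A \<Longrightarrow> hermitian (r *\<^sub>R A)"
  by (simp add: hermitian_def dagger_def vec_eq_iff)

lemma hermitian_real_diag: "hermitian (real_diag d)"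
  by (simp add: hermitian_def dagger_def real_diag_def vec_eq_iff)

lemma hermitian_congruence: "hermitian A \<Longrightarrow> hermitian (B ** A ** dagger B)"
  by (simp add: hermitian_def dagger_mult dagger_dagger matrix_mul_assoc)

lemma trace_scaleR: "trace (r *\<^sub>R A) = complex_of_real r * trace A"
  by (simp add: trace_def sum_distrib_left) (simp add: scaleR_conv_of_real)

text \<open>The trace is the sum of the squared moduli of the entries. Its nonnegativity later keeps
  the argument of the logarithm positive.\<close>

lemma trace_hermitian_square:
  assumes "hermitian A"
  obtains r where "trace (A ** A) = complex_of_real r" and "0 \<le> r"
proof -
  have "A $ i $ j * A $ j $ i = complex_of_real ((cmod (A $ i $ j))\<^sup>2)" for i j
    by (subst hermitian_nth[OF assms, of j i]) (simp only: complex_norm_square)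
  then have "trace (A ** A) = complex_of_real (\<Sum>i\<in>UNIV. \<Sum>j\<in>UNIV. (cmod (A $ i $ j))\<^sup>2)"
    by (simp add: trace_def matrix_matrix_mult_def)
  then show thesis by (rule that) (simp add: sum_nonneg)
qed

section \<open>Powers of Hermitian matrices\<close>

lemma real_diag_mult: "real_diag d ** real_diag e = real_diag (\<lambda>i. d i * e i)"
  unfolding vec_eq_iff real_diag_mult_left by (simp add: real_diag_def)

lemma unitary_conjugation_mult:
  assumes "unitary U"
  shows "(U ** A ** dagger U) ** (U ** B ** dagger U) = U ** (A ** B) ** dagger U"
proof -
  have "(U ** A ** dagger U) ** (U ** B ** dagger U) = U ** A ** (dagger U ** U) ** B ** dagger U"
    by (simp add: matrix_mul_assoc)
  also have "\<dots> = U ** A ** mat 1 ** B ** dagger U"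
    using assms by (simp only: unitary_def)
  finally show ?thesis by (simp add: matrix_mul_assoc)
qed

lemma matrix_powr_diagonalised:
  assumes "unitary U"
  shows "matrix_powr (U ** real_diag d ** dagger U) s = U ** real_diag (\<lambda>i. d i powr s) ** dagger U"
  unfolding matrix_powr_def using hermitian_fun_eqI[OF assms refl] by (simp add: comp_def)

text \<open>Replaces the outer power in the entropy of order 2 by a matrix product.\<close>

lemma matrix_powr_2:
  assumes "hermitian A"
  shows "matrix_powr A 2 = A ** A"
proof -
  obtain U d where U: "unitary U" and A: "A = U ** real_diag d ** dagger U"
    using hermitian_diagonalisable[OF assms] .
  \<comment> \<open>Eigenvalues may be negative here. As the real \<open>ln\<close> agrees at
    \<open>x\<close> and \<open>- x\<close>, so does \<open>powr\<close>, and the exponent 2 still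
    gives the square.\<close>
  have "x powr 2 = x * x" for x :: real
  proof -
    have "x powr 2 = \<bar>x\<bar> powr 2" by (simp add: powr_def abs_if ln_minus)
    then show ?thesis by (simp add: power2_eq_square)
  qed
  then show ?thesis
    by (simp add: A matrix_powr_diagonalised[OF U] unitary_conjugation_mult[OF U] real_diag_mult)
qed

section \<open>Positive semidefinite matrices and quantum states\<close>

lemma positive_semidefinite_diagonalisable:
  fixes A :: "complex ^ 'n ^ 'n"
  assumes "positive_semidefinite A"
  obtains U d where "unitary U" and "A = U ** real_diag d ** dagger U" and "\<And>i. 0 \<le> d i"
proof -
  obtain U d where U: "unitary U" and A: "A = U ** real_diag d ** dagger U"
    using hermitian_diagonalisable assms positive_semidefinite_def by metis
  have "0 \<le> d j" for j
  proof -
    \<comment> \<open>Column \<open>j\<close> of \<open>U\<close> is a unit eigenvector, so the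
      quadratic form at \<open>v\<close> is exactly \<open>d j\<close>.\<close>
    define v where "v = (\<chi> i. U $ i $ j)"
    have AU: "A ** U = U ** real_diag d"
    proof -
      have "A ** U = U ** real_diag d ** (dagger U ** U)" by (simp add: A matrix_mul_assoc)
      then show ?thesis using U by (simp add: unitary_def)
    qed
    have "(A *v v) $ i = v $ i * complex_of_real (d j)" for i
    proof -
      have "(A *v v) $ i = (A ** U) $ i $ j"
        by (simp add: v_def matrix_matrix_mult_def matrix_vector_mult_def)
      then show ?thesis by (simp add: AU real_diag_mult_right v_def)
    qed
    then have "(\<Sum>i\<in>UNIV. cnj (v $ i) * (A *v v) $ i) =
        (dagger U ** U) $ j $ j * complex_of_real (d j)"
      by (simp add: matrix_matrix_mult_def v_def dagger_def sum_distrib_right mult.assoc)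
    also have "\<dots> = complex_of_real (d j)"
      using U by (simp add: unitary_def mat_def)
    finally show ?thesis
      using assms unfolding positive_semidefinite_def by (metis Re_complex_of_real)
  qed
  with U A show thesis by (intro that)
qed

lemma positive_semidefinite_add:
  "positive_semidefinite A \<Longrightarrow> positive_semidefinite B \<Longrightarrow> positive_semidefinite (A + B)"
  by (simp add: positive_semidefinite_def hermitian_add matrix_vector_mult_add_rdistrib
      distrib_left sum.distrib)

lemma positive_semidefinite_scaleR:
  assumes "positive_semidefinite A" and "0 \<le> r"
  shows "positive_semidefinite (r *\<^sub>R A)"
proof -
  have "(r *\<^sub>R A *v v) $ i = r *\<^sub>R (A *v v) $ i" for v i
    by (simp add: matrix_vector_mult_def scaleR_sum_right)
  then have "(\<Sum>i\<in>UNIV. cnj (v $ i) * (r *\<^sub>R A *v v) $ i) =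
      r *\<^sub>R (\<Sum>i\<in>UNIV. cnj (v $ i) * (A *v v) $ i)" for v
    by (simp add: scaleR_sum_right)
  with assms show ?thesis
    by (simp add: positive_semidefinite_def hermitian_scaleR)
qed

lemma quantum_state_hermitian: "quantum_state A \<Longrightarrow> hermitian A"
  by (simp add: quantum_state_def positive_semidefinite_def)

lemma quantum_state_midpoint:
  assumes "quantum_state A" and "quantum_state B"
  shows "quantum_state ((1/2) *\<^sub>R (A + B))"
  using assms by (simp add: quantum_state_def positive_semidefinite_add
      positive_semidefinite_scaleR trace_scaleR trace_add)

section \<open>Tensor products and their powers\<close>

lemma tensor_mult: "(A \<otimes> B) ** (C \<otimes> D) = (A ** C) \<otimes> (B ** D)"
proof -
  have "((A \<otimes> B) ** (C \<otimes> D)) $ p $ q = ((A ** C) \<otimes> (B ** D)) $ p $ q" for p q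
    by (simp add: tensor_def matrix_matrix_mult_def UNIV_Times_UNIV[symmetric] sum_product
        sum.cartesian_product case_prod_beta mult_ac del: UNIV_Times_UNIV)
  then show ?thesis by (simp add: vec_eq_iff)
qed

lemma trace_tensor: "trace (A \<otimes> B) = trace A * trace B"
  by (simp add: tensor_def trace_def UNIV_Times_UNIV[symmetric] sum_product
        sum.cartesian_product case_prod_beta del: UNIV_Times_UNIV)

lemma dagger_tensor: "dagger (A \<otimes> B) = dagger A \<otimes> dagger B"
  by (simp add: tensor_def dagger_def vec_eq_iff)

lemma tensor_mat_1: "mat 1 \<otimes> mat 1 = mat 1"
  by (auto simp: tensor_def mat_def vec_eq_iff)

lemma real_diag_tensor: "real_diag d \<otimes> real_diag e = real_diag (\<lambda>p. d (fst p) * e (snd p))"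
  by (auto simp: tensor_def real_diag_def vec_eq_iff prod_eq_iff)

lemma unitary_tensor: "unitary U \<Longrightarrow> unitary V \<Longrightarrow> unitary (U \<otimes> V)"
  by (simp add: unitary_def dagger_tensor tensor_mult tensor_mat_1)

lemma hermitian_tensor: "hermitian A \<Longrightarrow> hermitian B \<Longrightarrow> hermitian (A \<otimes> B)"
  by (simp add: hermitian_def dagger_tensor)

lemma tensor_add_left: "(A + B) \<otimes> C = A \<otimes> C + B \<otimes> C"
  by (simp add: tensor_def vec_eq_iff algebra_simps)

lemma tensor_add_right: "A \<otimes> (B + C) = A \<otimes> B + A \<otimes> C"
  by (simp add: tensor_def vec_eq_iff algebra_simps)

lemma tensor_diff_left: "(A - B) \<otimes> C = A \<otimes> C - B \<otimes> C"
  by (simp add: tensor_def vec_eq_iff algebra_simps)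

lemma tensor_diff_right: "A \<otimes> (B - C) = A \<otimes> B - A \<otimes> C"
  by (simp add: tensor_def vec_eq_iff algebra_simps)

lemma tensor_scaleR_left: "(r *\<^sub>R A) \<otimes> B = r *\<^sub>R (A \<otimes> B)"
  by (simp add: tensor_def vec_eq_iff)

lemma tensor_scaleR_right: "A \<otimes> (r *\<^sub>R B) = r *\<^sub>R (A \<otimes> B)"
  by (simp add: tensor_def vec_eq_iff)

text \<open>The eigenvalues of a tensor product are products of eigenvalues, and \<open>powr\<close>
  is multiplicative. This includes the value 0, so the convention of powers on the support is
  compatible with tensor products.\<close>

lemma matrix_powr_tensor:
  assumes "hermitian A" and "hermitian B"
  shows "matrix_powr (A \<otimes> B) s = matrix_powr A s \<otimes> matrix_powr B s"
proof -
  obtain U d where U: "unitary U" and A: "A = U ** real_diag d ** dagger U"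
    using hermitian_diagonalisable[OF assms(1)] .
  obtain V e where V: "unitary V" and B: "B = V ** real_diag e ** dagger V"
    using hermitian_diagonalisable[OF assms(2)] .
  have AB: "A \<otimes> B = (U \<otimes> V) ** real_diag (\<lambda>p. d (fst p) * e (snd p)) ** dagger (U \<otimes> V)"
    by (simp add: A B dagger_tensor tensor_mult flip: real_diag_tensor)
  have "matrix_powr (A \<otimes> B) s =
      (U \<otimes> V) ** real_diag (\<lambda>p. (d (fst p) * e (snd p)) powr s) ** dagger (U \<otimes> V)"
    unfolding AB by (rule matrix_powr_diagonalised[OF unitary_tensor[OF U V]])
  also have "\<dots> = (U ** real_diag (\<lambda>i. d i powr s) ** dagger U) \<otimes>
      (V ** real_diag (\<lambda>i. e i powr s) ** dagger V)"
    by (simp only: powr_mult dagger_tensor tensor_mult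
        real_diag_tensor[of "\<lambda>i. d i powr s" "\<lambda>i. e i powr s", symmetric])
  finally show ?thesis
    by (simp only: A B matrix_powr_diagonalised[OF U] matrix_powr_diagonalised[OF V])
qed

section \<open>Sandwiching by a negative power\<close>

lemma hermitian_matrix_powr:
  assumes "hermitian A"
  shows "hermitian (matrix_powr A s)"
proof -
  obtain U d where "unitary U" and "A = U ** real_diag d ** dagger U"
    using hermitian_diagonalisable[OF assms] .
  then show ?thesis
    by (simp add: matrix_powr_diagonalised hermitian_congruence hermitian_real_diag)
qed

lemma hermitian_sandwich: "hermitian T \<Longrightarrow> hermitian A \<Longrightarrow> hermitian (T ** A ** T)"
  using hermitian_congruence[of A T] by (simp add: hermitian_def)

text \<open>The sandwiched matrix is the square root of \<open>A\<close>, because the exponents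
  -1/4, 1 and -1/4 add up to 1/2 on each positive eigenvalue.\<close>

lemma sandwich_powr_square:
  assumes "positive_semidefinite A"
  defines "T \<equiv> matrix_powr A (- (1/4))"
  shows "(T ** A ** T) ** (T ** A ** T) = A"
proof -
  obtain U d where U: "unitary U" and A: "A = U ** real_diag d ** dagger U" and d: "\<And>i. 0 \<le> d i"
    using positive_semidefinite_diagonalisable[OF assms(1)] by blast
  define g where "g = (\<lambda>i. d i powr (- (1/4)) * d i * d i powr (- (1/4)))"
  have "T ** A ** T = U ** real_diag g ** dagger U"
    unfolding T_def A matrix_powr_diagonalised[OF U] unitary_conjugation_mult[OF U] real_diag_mult
    by (simp add: g_def)
  moreover have "g i * g i = d i" for i
  \<comment> \<open>At eigenvalue zero both sides vanish, since
    \<open>0 powr (- (1/4)) = 0\<close>.\<close>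
  proof (cases "d i = 0")
    case False
    with d[of i] have p: "d i > 0" by simp
    have "g i = d i powr (- (1/4)) * d i powr 1 * d i powr (- (1/4))" using p by (simp add: g_def)
    also have "\<dots> = d i powr (- (1/4) + 1 + - (1/4))" by (simp only: powr_add)
    also have "- (1/4) + 1 + - (1/4) = (1/2 :: real)" by simp
    finally show ?thesis using p by (simp flip: powr_add)
  qed (simp add: g_def)
  ultimately show ?thesis
    by (simp add: unitary_conjugation_mult[OF U] real_diag_mult A)
qed

section \<open>Basis projectors and partial traces\<close>

lemma basis_projector_mult:
  "basis_projector x ** basis_projector y = (if x = y then basis_projector x else 0)"
proof -
  have "(basis_projector x ** basis_projector y) $ i $ j =
      (\<Sum>k\<in>UNIV. if k = x then (if i = x \<and> x = y \<and> j = y then 1 else 0) else 0)" for i j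
    unfolding matrix_matrix_mult_def basis_projector_def vec_lambda_beta
    by (rule sum.cong) auto
  then show ?thesis by (auto simp: vec_eq_iff basis_projector_def)
qed

lemma trace_basis_projector: "trace (basis_projector x) = 1"
  by (simp add: trace_def basis_projector_def)

lemma hermitian_basis_projector: "hermitian (basis_projector x)"
  by (auto simp: hermitian_def dagger_def basis_projector_def vec_eq_iff)

lemma trace_out_first_add: "trace_out_first (A + B) = trace_out_first A + trace_out_first B"
  by (simp add: trace_out_first_def vec_eq_iff sum.distrib)

lemma trace_out_first_scaleR: "trace_out_first (r *\<^sub>R A) = r *\<^sub>R trace_out_first A"
  by (simp add: trace_out_first_def vec_eq_iff scaleR_sum_right)

lemma trace_out_first_projector: "trace_out_first (basis_projector x \<otimes> B) = B"
proof -
  have "(trace_out_first (basis_projector x \<otimes> B)) $ i $ j = trace (basis_projector x) * B $ i $ j" for i j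
    by (simp add: trace_out_first_def tensor_def trace_def sum_distrib_right)
  then show ?thesis by (simp add: vec_eq_iff trace_basis_projector)
qed

lemma trace_out_second_add: "trace_out_second (A + B) = trace_out_second A + trace_out_second B"
  by (simp add: trace_out_second_def vec_eq_iff sum.distrib)

lemma trace_out_second_scaleR: "trace_out_second (r *\<^sub>R A) = r *\<^sub>R trace_out_second A"
  by (simp add: trace_out_second_def vec_eq_iff scaleR_sum_right)

lemma trace_out_second_projector:
  "trace_out_second (A \<otimes> basis_projector x \<otimes> B) = A \<otimes> B"
proof -
  have "(trace_out_second (A \<otimes> basis_projector x \<otimes> B)) $ i $ j =
      trace (basis_projector x) * (A \<otimes> B) $ i $ j" for i j
    by (simp add: trace_out_second_def tensor_def trace_def sum_distrib_right sum_distrib_left mult_ac)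
  then show ?thesis by (simp add: vec_eq_iff trace_basis_projector)
qed

section \<open>Classical-quantum states with a uniform bit\<close>

definition cq_state :: "complex ^ 'b ^ 'b \<Rightarrow> complex ^ 'b ^ 'b \<Rightarrow>
    complex ^ (2 \<times> 'b::finite) ^ (2 \<times> 'b)" where
  "cq_state A B = (1/2) *\<^sub>R (basis_projector 0 \<otimes> A) + (1/2) *\<^sub>R (basis_projector 1 \<otimes> B)"

lemma trace_out_first_cq_state: "trace_out_first (cq_state A B) = (1/2) *\<^sub>R (A + B)"
  by (simp add: cq_state_def trace_out_first_add trace_out_first_scaleR trace_out_first_projector
      scaleR_add_right)

lemma hermitian_cq_state: "hermitian A \<Longrightarrow> hermitian B \<Longrightarrow> hermitian (cq_state A B)"
  by (simp add: cq_state_def hermitian_add hermitian_scaleR hermitian_tensor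
      hermitian_basis_projector)

text \<open>Sandwiching acts on the second register only, so the two blocks stay separate. The new
  blocks are in general no states, which is why \<open>cq_state\<close> takes arbitrary
  matrices.\<close>

lemma sandwich_cq_state:
  "(mat 1 \<otimes> T) ** cq_state A B ** (mat 1 \<otimes> T) = cq_state (T ** A ** T) (T ** B ** T)"
  by (simp add: cq_state_def matrix_add_ldistrib matrix_add_rdistrib matrix_scalar_ac tensor_mult
      flip: scalar_matrix_assoc)

text \<open>The two projectors are orthogonal, so the mixed products vanish. The factor 1/4 is the
  square of the probability of a bit value.\<close>

lemma trace_cq_state_square:
  "trace (cq_state A B ** cq_state A B) = 1/4 * (trace (A ** A) + trace (B ** B))"
  by (simp add: cq_state_def matrix_add_ldistrib matrix_add_rdistrib matrix_scalar_ac tensor_mult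
      basis_projector_mult trace_add trace_scaleR trace_tensor trace_basis_projector trace_0[unfolded mat_0]
      distrib_left flip: scalar_matrix_assoc)

section \<open>Square roots and tensor products of states\<close>

lemma positive_semidefinite_square:
  assumes "hermitian R"
  shows "positive_semidefinite (R ** R)"
proof -
  have "(\<Sum>i\<in>UNIV. cnj (v $ i) * (R ** R *v v) $ i) = cinner (R *v v) (R *v v)" for v
    using cinner_hermitian[OF assms, of v "R *v v"] by (simp add: cinner_def matrix_vector_mul_assoc)
  then show ?thesis
    using hermitian_congruence[of "mat 1" R] assms
    by (simp add: positive_semidefinite_def cinner_self hermitian_def dagger_mult)
qed

lemma positive_semidefinite_root:
  assumes "positive_semidefinite A"
  obtains R where "hermitian R" and "A = R ** R"
proof
  let ?R = "matrix_powr A (- (1/4)) ** A ** matrix_powr A (- (1/4))"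
  show "hermitian ?R"
    using assms by (simp add: positive_semidefinite_def hermitian_sandwich hermitian_matrix_powr)
  show "A = ?R ** ?R"
    using assms by (simp add: sandwich_powr_square)
qed

text \<open>If both factors are squares of Hermitian matrices, then so is the tensor product. This
  settles positivity on entangled vectors as well.\<close>

lemma positive_semidefinite_tensor:
  assumes "positive_semidefinite A" and "positive_semidefinite B"
  shows "positive_semidefinite (A \<otimes> B)"
proof -
  obtain R where R: "hermitian R" "A = R ** R"
    using positive_semidefinite_root[OF assms(1)] .
  obtain S where S: "hermitian S" "B = S ** S"
    using positive_semidefinite_root[OF assms(2)] .
  show ?thesis
    using positive_semidefinite_square[OF hermitian_tensor[OF R(1) S(1)]]
    by (simp add: R S tensor_mult)
qed

lemma quantum_state_tensor:
  "quantum_state A \<Longrightarrow> quantum_state B \<Longrightarrow> quantum_state (A \<otimes> B)"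
  by (simp add: quantum_state_def positive_semidefinite_tensor trace_tensor)

section \<open>The entropy of order 2 through the sandwiched difference\<close>

lemma trace_parallelogram:
  fixes A B :: "complex ^ 'n ^ 'n"
  shows "trace (A ** A) + trace (B ** B) =
    2 * (trace (((1/2) *\<^sub>R (A + B)) ** ((1/2) *\<^sub>R (A + B))) +
         trace (((1/2) *\<^sub>R (A - B)) ** ((1/2) *\<^sub>R (A - B))))"
  by (simp add: matrix_add_ldistrib matrix_add_rdistrib matrix_diff_ldistrib matrix_diff_rdistrib
      matrix_scalar_ac trace_add trace_sub trace_scaleR
      field_simps flip: scalar_matrix_assoc)

text \<open>The matrix \<open>D\<close> of the introductory outline. The factor 1/2 makes it exactly
  multiplicative when two bits are added.\<close>

definition sandwiched_difference :: "complex ^ 'b ^ 'b \<Rightarrow> complex ^ 'b ^ 'b \<Rightarrow> complex ^ 'b ^ 'b" where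
  "sandwiched_difference A B =
     (let T = matrix_powr ((1/2) *\<^sub>R (A + B)) (- (1/4)) in T ** ((1/2) *\<^sub>R (A - B)) ** T)"

lemma hermitian_sandwiched_difference:
  "hermitian A \<Longrightarrow> hermitian B \<Longrightarrow> hermitian (sandwiched_difference A B)"
  by (simp add: sandwiched_difference_def Let_def hermitian_sandwich hermitian_matrix_powr
      hermitian_scaleR hermitian_add hermitian_diff)

text \<open>Being a state is asked of the mean, whose positivity and unit trace enter the
  computation. For the two parity blocks this mean is a product of states.\<close>

lemma sandwiched_entropy_down_cq_state:
  assumes A: "hermitian A" and B: "hermitian B" and state: "quantum_state ((1/2) *\<^sub>R (A + B))"
  defines "D \<equiv> sandwiched_difference A B"
  shows "sandwiched_entropy_down 2 (cq_state A B) = - ln ((1 + Re (trace (D ** D))) / 2)"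
proof -
  define M where "M = (1/2) *\<^sub>R (A + B)"
  \<comment> \<open>The exponent is \<open>(1 - \<alpha>) / (2 * \<alpha>)\<close> at \<alpha> =
    2.\<close>
  define T where "T = matrix_powr M (- (1/4))"
  have T: "hermitian T"
    by (simp add: T_def M_def hermitian_matrix_powr hermitian_scaleR hermitian_add A B)
  let ?A = "T ** A ** T" and ?B = "T ** B ** T"
  have mean: "(1/2) *\<^sub>R (?A + ?B) = T ** M ** T"
    by (simp add: M_def matrix_add_ldistrib matrix_add_rdistrib matrix_scalar_ac scaleR_add_right
        flip: scalar_matrix_assoc)
  have diff: "(1/2) *\<^sub>R (?A - ?B) = D"
    by (simp add: D_def sandwiched_difference_def Let_def M_def[symmetric] T_def[symmetric]
        matrix_diff_ldistrib matrix_diff_rdistrib matrix_scalar_ac scaleR_diff_right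
        flip: scalar_matrix_assoc)
  \<comment> \<open>The sandwiched mean squares back to \<open>M\<close>, whose unit trace is the
    constant 1 in the formula.\<close>
  have "(T ** M ** T) ** (T ** M ** T) = M"
    using sandwich_powr_square[of M] state by (simp add: T_def M_def quantum_state_def)
  then have tr: "trace (?A ** ?A) + trace (?B ** ?B) = 2 * (1 + trace (D ** D))"
    using trace_parallelogram[of ?A ?B] state unfolding mean diff
    by (simp add: M_def quantum_state_def)
  have "matrix_powr (cq_state ?A ?B) 2 = cq_state ?A ?B ** cq_state ?A ?B"
    by (intro matrix_powr_2 hermitian_cq_state hermitian_sandwich T A B)
  then have "sandwiched_entropy_down 2 (cq_state A B) =
      - ln (Re (trace (cq_state ?A ?B ** cq_state ?A ?B)))"
    by (simp add: sandwiched_entropy_down_def Let_def trace_out_first_cq_state M_def[symmetric]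
        T_def[symmetric] sandwich_cq_state)
  \<comment> \<open>The 1/4 from the bit probabilities and the 2 from the parallelogram identity
    combine to one half.\<close>
  also have "Re (trace (cq_state ?A ?B ** cq_state ?A ?B)) = (1 + Re (trace (D ** D))) / 2"
    unfolding trace_cq_state_square tr by (simp add: field_simps)
  finally show ?thesis .
qed

text \<open>\<open>E\<close> and \<open>F\<close> collect the terms of even and odd parity.
  Expanding a product of two differences gives each term the sign of its parity, so the difference
  factorises just as the sum does. The powers of the mean factorise by
  \<open>matrix_powr_tensor\<close>.\<close>

lemma sandwiched_difference_parity:
  fixes A\<^sub>1 B\<^sub>1 :: "complex ^ 'b1 ^ 'b1" and A\<^sub>2 B\<^sub>2 :: "complex ^ 'b2 ^ 'b2"
  assumes "hermitian A\<^sub>1" "hermitian B\<^sub>1" "hermitian A\<^sub>2" "hermitian B\<^sub>2"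
  defines "E \<equiv> (1/2) *\<^sub>R (A\<^sub>1 \<otimes> A\<^sub>2 + B\<^sub>1 \<otimes> B\<^sub>2)" and "F \<equiv> (1/2) *\<^sub>R (B\<^sub>1 \<otimes> A\<^sub>2 + A\<^sub>1 \<otimes> B\<^sub>2)"
  shows "(1/2) *\<^sub>R (E + F) = ((1/2) *\<^sub>R (A\<^sub>1 + B\<^sub>1)) \<otimes> ((1/2) *\<^sub>R (A\<^sub>2 + B\<^sub>2))"
    and "sandwiched_difference E F = sandwiched_difference A\<^sub>1 B\<^sub>1 \<otimes> sandwiched_difference A\<^sub>2 B\<^sub>2"
proof -
  show mean: "(1/2) *\<^sub>R (E + F) = ((1/2) *\<^sub>R (A\<^sub>1 + B\<^sub>1)) \<otimes> ((1/2) *\<^sub>R (A\<^sub>2 + B\<^sub>2))"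
    by (simp add: E_def F_def tensor_add_left tensor_add_right tensor_scaleR_left
        tensor_scaleR_right algebra_simps)
  have diff: "(1/2) *\<^sub>R (E - F) = ((1/2) *\<^sub>R (A\<^sub>1 - B\<^sub>1)) \<otimes> ((1/2) *\<^sub>R (A\<^sub>2 - B\<^sub>2))"
    by (simp add: E_def F_def tensor_diff_left tensor_diff_right tensor_scaleR_left
        tensor_scaleR_right algebra_simps)
  show "sandwiched_difference E F = sandwiched_difference A\<^sub>1 B\<^sub>1 \<otimes> sandwiched_difference A\<^sub>2 B\<^sub>2"
    unfolding sandwiched_difference_def Let_def mean diff
    using assms(1-4) by (simp add: matrix_powr_tensor hermitian_scaleR hermitian_add tensor_mult)
qed

theorem propositionV3:
  fixes \<sigma>\<^sub>1 :: "2 \<Rightarrow> complex ^ 'b1 ^ 'b1"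
    and \<sigma>\<^sub>2 :: "2 \<Rightarrow> complex ^ 'b2 ^ 'b2"
    and \<rho>\<^sub>1 :: "complex ^ (2 \<times> 'b1::finite) ^ (2 \<times> 'b1)"
    and \<rho>\<^sub>2 :: "complex ^ (2 \<times> 'b2::finite) ^ (2 \<times> 'b2)"
    and \<tau> :: "complex ^ (2 \<times> 2 \<times> 'b1::finite \<times> 'b2::finite) ^ (2 \<times> 2 \<times> 'b1 \<times> 'b2)"
  assumes "quantum_state (\<sigma>\<^sub>1 0)" and "quantum_state (\<sigma>\<^sub>1 1)"
    and "quantum_state (\<sigma>\<^sub>2 0)" and "quantum_state (\<sigma>\<^sub>2 1)"
    and "\<rho>\<^sub>1 = (1/2) *\<^sub>R (basis_projector 0 \<otimes> \<sigma>\<^sub>1 0) + (1/2) *\<^sub>R (basis_projector 1 \<otimes> \<sigma>\<^sub>1 1)"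
    and "\<rho>\<^sub>2 = (1/2) *\<^sub>R (basis_projector 0 \<otimes> \<sigma>\<^sub>2 0) + (1/2) *\<^sub>R (basis_projector 1 \<otimes> \<sigma>\<^sub>2 1)"
    and "\<tau> = (\<Sum>x\<^sub>1\<in>{0, 1}. \<Sum>x\<^sub>2\<in>{0, 1}.
                (1/4) *\<^sub>R (basis_projector (x\<^sub>1 + x\<^sub>2) \<otimes> basis_projector x\<^sub>2 \<otimes> \<sigma>\<^sub>1 x\<^sub>1 \<otimes> \<sigma>\<^sub>2 x\<^sub>2))"
  shows "sandwiched_entropy_down 2 (trace_out_second \<tau>) =
     - ln (2 * (1/2 - exp (- sandwiched_entropy_down 2 \<rho>\<^sub>1))
             * (1/2 - exp (- sandwiched_entropy_down 2 \<rho>\<^sub>2)) + 1/2)"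
proof -
  note herm = assms(1-4)[THEN quantum_state_hermitian]
  \<comment> \<open>\<open>E\<close> and \<open>F\<close> are the conditional states of the joint
    system given that the sum of the bits is 0 or 1.\<close>
  define E where "E = (1/2) *\<^sub>R (\<sigma>\<^sub>1 0 \<otimes> \<sigma>\<^sub>2 0 + \<sigma>\<^sub>1 1 \<otimes> \<sigma>\<^sub>2 1)"
  define F where "F = (1/2) *\<^sub>R (\<sigma>\<^sub>1 1 \<otimes> \<sigma>\<^sub>2 0 + \<sigma>\<^sub>1 0 \<otimes> \<sigma>\<^sub>2 1)"
  define D\<^sub>1 where "D\<^sub>1 = sandwiched_difference (\<sigma>\<^sub>1 0) (\<sigma>\<^sub>1 1)"
  define D\<^sub>2 where "D\<^sub>2 = sandwiched_difference (\<sigma>\<^sub>2 0) (\<sigma>\<^sub>2 1)"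
  obtain r\<^sub>1 where r1: "trace (D\<^sub>1 ** D\<^sub>1) = complex_of_real r\<^sub>1" "0 \<le> r\<^sub>1"
    using trace_hermitian_square[OF hermitian_sandwiched_difference] herm
    unfolding D\<^sub>1_def by blast
  obtain r\<^sub>2 where r2: "trace (D\<^sub>2 ** D\<^sub>2) = complex_of_real r\<^sub>2" "0 \<le> r\<^sub>2"
    using trace_hermitian_square[OF hermitian_sandwiched_difference] herm
    unfolding D\<^sub>2_def by blast
  have "sandwiched_entropy_down 2 \<rho>\<^sub>1 = - ln ((1 + r\<^sub>1) / 2)"
    using sandwiched_entropy_down_cq_state[of "\<sigma>\<^sub>1 0" "\<sigma>\<^sub>1 1"] herm
      quantum_state_midpoint[OF assms(1,2)] r1
    by (simp add: assms(5) D\<^sub>1_def flip: cq_state_def)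
  \<comment> \<open>Since \<open>r\<^sub>1\<close> is nonnegative, the argument of \<open>ln\<close>
    is positive and \<open>exp\<close> undoes it.\<close>
  then have e1: "exp (- sandwiched_entropy_down 2 \<rho>\<^sub>1) = (1 + r\<^sub>1) / 2"
    using r1 by simp
  have "sandwiched_entropy_down 2 \<rho>\<^sub>2 = - ln ((1 + r\<^sub>2) / 2)"
    using sandwiched_entropy_down_cq_state[of "\<sigma>\<^sub>2 0" "\<sigma>\<^sub>2 1"] herm
      quantum_state_midpoint[OF assms(3,4)] r2
    by (simp add: assms(6) D\<^sub>2_def flip: cq_state_def)
  then have e2: "exp (- sandwiched_entropy_down 2 \<rho>\<^sub>2) = (1 + r\<^sub>2) / 2"
    using r2 by simp
  \<comment> \<open>The label \<open>1 + 1\<close> simplifies to the numeral 2, which is zero in the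
    integers modulo two.\<close>
  have two: "(2 :: 2) = 0" by simp
  have "trace_out_second \<tau> = cq_state E F"
    by (simp add: assms(7) two cq_state_def E_def F_def trace_out_second_add trace_out_second_scaleR
        trace_out_second_projector tensor_add_right tensor_scaleR_right scaleR_add_right)
  moreover have "hermitian E" "hermitian F"
    using herm by (simp_all add: E_def F_def hermitian_scaleR hermitian_add hermitian_tensor)
  moreover have "quantum_state ((1/2) *\<^sub>R (E + F))"
    using herm sandwiched_difference_parity(1)[of "\<sigma>\<^sub>1 0" "\<sigma>\<^sub>1 1" "\<sigma>\<^sub>2 0" "\<sigma>\<^sub>2 1"]
      quantum_state_tensor[OF quantum_state_midpoint quantum_state_midpoint, OF assms(1-4)]
    by (simp add: E_def F_def)
  moreover have "sandwiched_difference E F = D\<^sub>1 \<otimes> D\<^sub>2"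
    using herm sandwiched_difference_parity(2) by (simp add: E_def F_def D\<^sub>1_def D\<^sub>2_def)
  ultimately have "sandwiched_entropy_down 2 (trace_out_second \<tau>) = - ln ((1 + r\<^sub>1 * r\<^sub>2) / 2)"
    using r1 r2 by (simp add: sandwiched_entropy_down_cq_state tensor_mult trace_tensor)
  \<comment> \<open>Each difference \<open>1/2 - (1 + r) / 2\<close> is \<open>- r / 2\<close>. The
    two signs cancel, and the factor 2 leaves half the product.\<close>
  also have "(1 + r\<^sub>1 * r\<^sub>2) / 2 = 2 * (1/2 - (1 + r\<^sub>1) / 2) * (1/2 - (1 + r\<^sub>2) / 2) + 1/2"
    by (simp add: field_simps)
  finally show ?thesis by (simp only: e1 e2)
qed

end
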